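(* Let $N, r$ be positive integers and suppose $X_1,\ldots,X_N$ is a perfect split point configuration of $N$ color classes of $r$ points each in $\mathbb{R}^d$. Then for any colorful partition $A_1,\ldots,A_r$ of $X_1\cup\cdots\cup X_N$ into $r$ parts which is a Tverberg partition, there exists a choice of (at most) $p_r N$ color classes whose removal breaks it, i.e. after deleting all points of these color classes, the convex hulls of the remaining parts have empty intersection.
   Context: Given $N$ color classes (disjoint sets) of $r$ points of $\mathbb{R}^d$ each, they form a perfect split point configuration if there exist $r$ open half-spaces in $\mathbb{R}^d$ such that (i) the intersection of all $r$ half-spaces is empty, and (ii) for every color class, each of the half-spaces contains exactly $r-1$ of the $r$ points of that color class. A colorful partition is a partition of the union of the color classes into $r$ parts so that each part contains exactly one point of each color class; it is a Tverberg partition if the convex hulls of its parts have a common point. Removing a color class means deleting all its points from all parts. $p_r$ denotes the probability that a uniformly random permutation of $\{1,\ldots,r\}$ has at least one fixed point. *)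

theory Defs
  imports
    "HOL-Analysis.Analysis"
    "HOL-Probability.Probability"
    "HOL-Combinatorics.Permutations"
begin

definition open_halfspace :: "(real ^ 'd) set \<Rightarrow> bool" where
  "open_halfspace H \<longleftrightarrow> (\<exists>a b. a \<noteq> 0 \<and> H = {x. a \<bullet> x < b})"

definition color_classes :: "nat \<Rightarrow> nat \<Rightarrow> (nat \<Rightarrow> (real ^ 'd) set) \<Rightarrow> bool" where
  "color_classes N r X \<longleftrightarrow>
     disjoint_family_on X {1..N} \<and> (\<forall>i\<in>{1..N}. finite (X i) \<and> card (X i) = r)"

definition perfect_split :: "nat \<Rightarrow> nat \<Rightarrow> (nat \<Rightarrow> (real ^ 'd) set) \<Rightarrow> bool" where
  "perfect_split N r X \<longleftrightarrow>
     color_classes N r X \<and>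
     (\<exists>H. (\<forall>j\<in>{1..r}. open_halfspace (H j)) \<and>
          (\<Inter>j\<in>{1..r}. H j) = {} \<and>
          (\<forall>i\<in>{1..N}. \<forall>j\<in>{1..r}. card (X i \<inter> H j) = r - 1))"

text \<open>Nonemptiness of the parts is implied by the last conjunct as soon as \<open>N \<ge> 1\<close>.\<close>

definition colorful_partition ::
  "nat \<Rightarrow> nat \<Rightarrow> (nat \<Rightarrow> (real ^ 'd) set) \<Rightarrow> (nat \<Rightarrow> (real ^ 'd) set) \<Rightarrow> bool" where
  "colorful_partition N r X A \<longleftrightarrow>
     disjoint_family_on A {1..r} \<and>
     (\<Union>k\<in>{1..r}. A k) = (\<Union>i\<in>{1..N}. X i) \<and>
     (\<forall>k\<in>{1..r}. \<forall>i\<in>{1..N}. card (A k \<inter> X i) = 1)"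

definition tverberg :: "nat \<Rightarrow> (nat \<Rightarrow> (real ^ 'd) set) \<Rightarrow> bool" where
  "tverberg r A \<longleftrightarrow> (\<Inter>k\<in>{1..r}. convex hull (A k)) \<noteq> {}"

definition remove_classes ::
  "(nat \<Rightarrow> (real ^ 'd) set) \<Rightarrow> nat set \<Rightarrow> (nat \<Rightarrow> (real ^ 'd) set) \<Rightarrow> nat \<Rightarrow> (real ^ 'd) set" where
  "remove_classes X S A k = A k - (\<Union>i\<in>S. X i)"

definition fixpoint_prob :: "nat \<Rightarrow> real" where
  "fixpoint_prob r =
     measure_pmf.prob (pmf_of_set {\<pi>. \<pi> permutes {1..r}}) {\<pi>. \<exists>i\<in>{1..r}. \<pi> i = i}"

end

theory Submission imports Defs begin

text \<open>
  In each color class every half-space misses exactly one point, and every point is missed by at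
  least one half-space, so points and half-spaces correspond bijectively. Hence a colorful partition
  gives for each class \<open>i\<close> a permutation \<open>\<pi>\<^sub>i\<close> such that \<open>H (\<pi>\<^sub>i k)\<close> is the only half-space missing the
  point of class \<open>i\<close> in part \<open>A k\<close>. For any permutation \<open>\<sigma>\<close>, removing the classes \<open>i\<close> for which
  \<open>\<pi>\<^sub>i\<close> and \<open>\<sigma>\<close> agree somewhere leaves \<open>A k\<close> inside \<open>H (\<sigma> k)\<close> for all \<open>k\<close>, so the hulls have no
  common point. For uniformly random \<open>\<sigma>\<close> each class is removed with probability \<open>p\<^sub>r\<close>, so some \<open>\<sigma>\<close>
  removes at most \<open>p\<^sub>r N\<close> classes.
\<close>

text \<open>Left composition with \<open>p\<close> is a bijection between the two sets: by
  injectivity of \<open>p\<close>, \<open>p x = p (q x)\<close> holds exactly when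
  \<open>q x = x\<close>. So the chance that a random permutation agrees somewhere with
  \<open>p\<close> does not depend on \<open>p\<close>.\<close>

lemma card_permutations_agreeing:
  assumes "p permutes S"
  shows "card {q. q permutes S \<and> (\<exists>x\<in>S. p x = q x)} = card {q. q permutes S \<and> (\<exists>x\<in>S. q x = x)}"
proof -
  have "bij_betw (\<lambda>q. p \<circ> q) {q. q permutes S \<and> (\<exists>x\<in>S. q x = x)}
          {q. q permutes S \<and> (\<exists>x\<in>S. p x = q x)}"
  proof (rule bij_betw_byWitness[where f' = "\<lambda>q. inv p \<circ> q"])
    show "(\<lambda>q. p \<circ> q) ` {q. q permutes S \<and> (\<exists>x\<in>S. q x = x)}
            \<subseteq> {q. q permutes S \<and> (\<exists>x\<in>S. p x = q x)}"
      by (auto intro: permutes_compose[OF _ assms]) metis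
    show "(\<lambda>q. inv p \<circ> q) ` {q. q permutes S \<and> (\<exists>x\<in>S. p x = q x)}
            \<subseteq> {q. q permutes S \<and> (\<exists>x\<in>S. q x = x)}"
      by (auto intro: permutes_compose[OF _ permutes_inv[OF assms]])
        (metis permutes_inverses(2)[OF assms])
  qed (simp_all add: fun_eq_iff permutes_inverses[OF assms])
  then show ?thesis
    by (simp add: bij_betw_same_card)
qed

text \<open>Double counting of the pairs \<open>(i, s)\<close> with \<open>R i s\<close>: if every
  \<open>s\<close> exceeded the average, summing over the nonempty \<open>P\<close> would give more
  than \<open>c * card I\<close> pairs. Multiplying by \<open>card P\<close> keeps the averages in
  the naturals.\<close>

lemma exists_le_average_card:
  assumes "finite P" "P \<noteq> {}" "finite I"
    and "\<And>i. i \<in> I \<Longrightarrow> card {s\<in>P. R i s} \<le> c"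
  shows "\<exists>s\<in>P. card {i\<in>I. R i s} * card P \<le> c * card I"
proof (rule ccontr)
  assume "\<not> ?thesis"
  then have less: "c * card I < card {i\<in>I. R i s} * card P" if "s \<in> P" for s
    using that by (simp add: not_le)
  have "card P * (c * card I) = (\<Sum>s\<in>P. c * card I)"
    by simp
  also have "\<dots> < (\<Sum>s\<in>P. card {i\<in>I. R i s} * card P)"
    using assms(1,2) less by (intro sum_strict_mono)
  also have "\<dots> = (\<Sum>s\<in>P. card {i\<in>I. R i s}) * card P"
    by (simp add: sum_distrib_right)
  also have "(\<Sum>s\<in>P. card {i\<in>I. R i s}) = (\<Sum>i\<in>I. card {s\<in>P. R i s})"
    using sum.swap_restrict[OF assms(1,3), of "\<lambda>_ _. 1::nat" "\<lambda>s i. R i s"] by simp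
  also have "\<dots> \<le> card I * c"
    using sum_bounded_above[of I "\<lambda>i. card {s\<in>P. R i s}" c] assms(4) by simp
  finally show False
    by (simp add: algebra_simps)
qed

lemma fixpoint_prob_eq:
  "fixpoint_prob r =
     card {p. p permutes {1..r} \<and> (\<exists>i\<in>{1..r}. p i = i)} / card {p. p permutes {1..r}}"
proof -
  have "{p. p permutes {1..r}} \<noteq> {}"
    using permutes_id by blast
  then show ?thesis
    unfolding fixpoint_prob_def
    by (subst measure_pmf_of_set) (auto simp: finite_permutations Int_def)
qed

lemma missing_halfspace_permutation:
  fixes H :: "nat \<Rightarrow> 'a set"
  assumes X: "finite X" "card X = r"
    and H: "(\<Inter>j\<in>{1..r}. H j) = {}" "\<forall>j\<in>{1..r}. card (X \<inter> H j) = r - 1"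
    and A: "disjoint_family_on A {1..r}" "\<forall>k\<in>{1..r}. card (A k \<inter> X) = 1"
  shows "\<exists>p. p permutes {1..r} \<and> (\<forall>k\<in>{1..r}. \<forall>j\<in>{1..r}. j \<noteq> p k \<longrightarrow> A k \<inter> X \<subseteq> H j)"
proof -
  \<comment> \<open>Since \<open>j\<close> lies in \<open>{1..r}\<close>, \<open>r\<close> is
    positive, so \<open>r - 1\<close> is a true difference and \<open>H j\<close> misses exactly one
    point of \<open>X\<close>.\<close>
  have miss1: "x = y"
    if "j \<in> {1..r}" "x \<in> X" "y \<in> X" "x \<notin> H j" "y \<notin> H j" for j x y
  proof -
    have "card (X - H j) = 1"
      using card_Diff_subset_Int[of X "H j"] X H(2) that(1) by auto
    then show ?thesis
      using that by (metis DiffI card_1_singletonE singletonD)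
  qed
  have "\<forall>k\<in>{1..r}. \<exists>x. A k \<inter> X = {x}"
    using A(2) by (simp add: card_1_singleton_iff)
  then obtain x where x: "A k \<inter> X = {x k}" if "k \<in> {1..r}" for k
    by (metis (no_types))
  have "\<forall>k\<in>{1..r}. \<exists>j\<in>{1..r}. x k \<notin> H j"
    using H(1) by blast
  then obtain f where f: "f k \<in> {1..r}" "x k \<notin> H (f k)" if "k \<in> {1..r}" for k
    by (metis (no_types))
  \<comment> \<open>Parts with the same missing half-space would share their point of
    \<open>X\<close>, contrary to disjointness.\<close>
  have "inj_on f {1..r}"
  proof (rule inj_onI)
    fix k l assume kl: "k \<in> {1..r}" "l \<in> {1..r}" "f k = f l"
    then have "x k = x l"
      using miss1[of "f k" "x k" "x l"] f x by (metis IntD2 insertI1)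
    then have "A k \<inter> A l \<noteq> {}"
      using x[OF kl(1)] x[OF kl(2)] by auto
    then show "k = l"
      using A(1) kl unfolding disjoint_family_on_def by blast
  qed
  moreover have "f ` {1..r} \<subseteq> {1..r}"
    using f by blast
  ultimately have surj: "f ` {1..r} = {1..r}" and bij: "bij_betw f {1..r} {1..r}"
    by (simp_all add: endo_inj_surj bij_betw_def)
  \<comment> \<open>\<open>permutes\<close> demands the identity outside \<open>{1..r}\<close>,
    where \<open>f\<close> is arbitrary.\<close>
  define p where "p k = (if k \<in> {1..r} then f k else k)" for k
  have "bij_betw p {1..r} {1..r}"
    using bij by (subst bij_betw_cong[of _ _ f]) (simp_all add: p_def)
  then have "p permutes {1..r}"
    by (rule bij_imp_permutes) (auto simp: p_def)
  moreover have "A k \<inter> X \<subseteq> H j" if k: "k \<in> {1..r}" and j: "j \<in> {1..r}" "j \<noteq> p k" for k j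
  proof (rule ccontr)
    assume "\<not> ?thesis"
    then have "x k \<notin> H j"
      using x[OF k] by auto
    \<comment> \<open>By surjectivity \<open>H j\<close> already misses the point \<open>x l\<close>
      of some part, and it has no room for a second one.\<close>
    obtain l where l: "l \<in> {1..r}" "j = f l"
      using surj j(1) by blast
    have "x k = x l"
      using miss1[OF j(1), of "x k" "x l"] \<open>x k \<notin> H j\<close> f(2)[OF l(1)] l(2) x[OF k] x[OF l(1)]
      by (metis IntD2 insertI1)
    then have "A k \<inter> A l \<noteq> {}"
      using x[OF k] x[OF l(1)] by auto
    then have "k = l"
      using A(1) k l(1) unfolding disjoint_family_on_def by blast
    then show False
      using j(2) k l(2) by (simp add: p_def)
  qed
  ultimately show ?thesis
    by blast
qed

theorem theorem2p2:
  fixes N r :: nat and X A :: "nat \<Rightarrow> (real ^ 'd) set"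
  assumes "N \<ge> 1" and "r \<ge> 1"
    and "perfect_split N r X"
    and "colorful_partition N r X A"
    and "tverberg r A"
  shows "\<exists>S \<subseteq> {1..N}. real (card S) \<le> fixpoint_prob r * real N \<and>
           (\<Inter>k\<in>{1..r}. convex hull (remove_classes X S A k)) = {}"
proof -
  obtain H where X: "\<forall>i\<in>{1..N}. finite (X i) \<and> card (X i) = r"
    and Hopen: "\<forall>j\<in>{1..r}. open_halfspace (H j)"
    and Hempty: "(\<Inter>j\<in>{1..r}. H j) = {}"
    and Hcard: "\<forall>i\<in>{1..N}. \<forall>j\<in>{1..r}. card (X i \<inter> H j) = r - 1"
    using assms(3) by (auto simp: perfect_split_def color_classes_def)
  have Hconvex: "convex (H j)" if "j \<in> {1..r}" for j
    using Hopen that by (metis open_halfspace_def convex_halfspace_lt)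
  have A: "disjoint_family_on A {1..r}" "(\<Union>k\<in>{1..r}. A k) = (\<Union>i\<in>{1..N}. X i)"
    "\<forall>k\<in>{1..r}. \<forall>i\<in>{1..N}. card (A k \<inter> X i) = 1"
    using assms(4) by (auto simp: colorful_partition_def)
  have "\<forall>i\<in>{1..N}. \<exists>p. p permutes {1..r} \<and>
          (\<forall>k\<in>{1..r}. \<forall>j\<in>{1..r}. j \<noteq> p k \<longrightarrow> A k \<inter> X i \<subseteq> H j)"
    using X Hempty Hcard A by (intro ballI missing_halfspace_permutation) auto
  from bchoice[OF this] obtain p where
    pH: "\<forall>i\<in>{1..N}. p i permutes {1..r} \<and>
          (\<forall>k\<in>{1..r}. \<forall>j\<in>{1..r}. j \<noteq> p i k \<longrightarrow> A k \<inter> X i \<subseteq> H j)"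
    by blast
  define P where "P = {s. s permutes {1..r}}"
  define D where "D = {s. s permutes {1..r} \<and> (\<exists>k\<in>{1..r}. s k = k)}"
  have P: "finite P" "P \<noteq> {}"
    using permutes_id[of "{1..r}"] by (auto simp: P_def finite_permutations simp del: permutes_id)
  \<comment> \<open>One bound serves all classes, and \<open>card D / card P\<close> is the
    fixed-point probability.\<close>
  have "card {s\<in>P. \<exists>k\<in>{1..r}. p i k = s k} \<le> card D" if "i \<in> {1..N}" for i
    using card_permutations_agreeing[of "p i" "{1..r}"] pH that by (simp add: P_def D_def)
  then obtain s where "s \<in> P"
    and s: "card {i\<in>{1..N}. \<exists>k\<in>{1..r}. p i k = s k} * card P \<le> card D * card {1..N}"
    using exists_le_average_card[OF P, of "{1..N}" "\<lambda>i s. \<exists>k\<in>{1..r}. p i k = s k" "card D"]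
    by auto
  define S where "S = {i\<in>{1..N}. \<exists>k\<in>{1..r}. p i k = s k}"
  have sperm: "s permutes {1..r}"
    using \<open>s \<in> P\<close> by (simp add: P_def)
  have "card P > 0"
    using P by (simp add: card_gt_0_iff)
  have "real (card S) * real (card P) \<le> real (card D) * real N"
    using s unfolding S_def[symmetric] by (metis card_atLeastAtMost diff_Suc_1 of_nat_le_iff of_nat_mult)
  then have "real (card S) \<le> fixpoint_prob r * real N"
    using \<open>card P > 0\<close> unfolding fixpoint_prob_eq P_def[symmetric] D_def[symmetric]
    by (simp add: field_simps)
  moreover have "convex hull (remove_classes X S A k) \<subseteq> H (s k)" if k: "k \<in> {1..r}" for k
  proof (rule hull_minimal)
    have sk: "s k \<in> {1..r}"
      using permutes_in_image[OF sperm] k by simp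
    then show "convex (H (s k))"
      by (rule Hconvex)
    show "remove_classes X S A k \<subseteq> H (s k)"
    proof
      fix x assume "x \<in> remove_classes X S A k"
      then have x: "x \<in> A k" "\<And>i. i \<in> S \<Longrightarrow> x \<notin> X i"
        by (auto simp: remove_classes_def)
      then obtain i where i: "i \<in> {1..N}" "x \<in> X i"
        using A(2) k by blast
      then have "i \<notin> S"
        using x(2) by blast
      \<comment> \<open>In a surviving class, \<open>s\<close> avoids the only half-space that may
        miss the point of part \<open>A k\<close>.\<close>
      then have "s k \<noteq> p i k"
        using i(1) k by (force simp: S_def)
      then have "A k \<inter> X i \<subseteq> H (s k)"
        using pH i(1) k sk by blast
      then show "x \<in> H (s k)"
        using x(1) i(2) by blast
    qed
  qed
  then have "(\<Inter>k\<in>{1..r}. convex hull (remove_classes X S A k)) \<subseteq> (\<Inter>k\<in>{1..r}. H (s k))"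
    by blast
  \<comment> \<open>\<open>s\<close> only reorders the half-spaces.\<close>
  moreover have "(\<Inter>k\<in>{1..r}. H (s k)) = {}"
    using Hempty permutes_image[OF sperm] image_image[of H s "{1..r}"] by simp
  moreover have "S \<subseteq> {1..N}"
    by (auto simp: S_def)
  ultimately show ?thesis
    by (intro exI[of _ S]) simp
qed

end
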